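(* Let $S$ be a numerical semigroup. Then the Apéry poset $(\operatorname{Ap}(S),\preceq)$ of $S$ is graded if and only if $S$ is Apéry half-factorial (AHF).
   Context: A numerical semigroup $S$ is a subset of $\mathbb{Z}_{\ge 0}$ with finite complement that contains $0$ and is closed under addition. Its atoms are the nonzero elements of $S$ that are not a sum of two nonzero elements of $S$; the set of atoms is finite. The multiplicity $m(S)$ is the smallest nonzero element of $S$. The Apéry set is $\operatorname{Ap}(S)=\{x\in S : x-m(S)\notin S\}$. The Apéry poset of $S$ is $\operatorname{Ap}(S)$ with the partial order $x\preceq y$ if and only if $y-x\in S$. A finite poset is graded if it admits a rank function, i.e. an integer-valued function $\mathrm{rk}$ with $\mathrm{rk}(y)=\mathrm{rk}(x)+1$ whenever $y$ covers $x$ (equivalently here, since $0$ is the unique minimal element: for each element $n$, all saturated chains from $0$ to $n$ have the same length; it is not required that all maximal elements have the same rank). For nonzero $x\in S$, the elasticity $\rho(x)$ is the largest number of atoms (counted with multiplicity) in an expression of $x$ as a sum of atoms, divided by the smallest such number; $\rho(0)=1$. An element is half-factorial if its elasticity is $1$. $S$ is Apéry half-factorial (AHF) if $\rho(x)=1$ for every $x\in\operatorname{Ap}(S)$. *)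

theory Defs
  imports Complex_Main "HOL-Library.Multiset"
begin

definition numerical_semigroup :: "nat set \<Rightarrow> bool" where
  "numerical_semigroup S \<longleftrightarrow>
     0 \<in> S \<and> (\<forall>x\<in>S. \<forall>y\<in>S. x + y \<in> S) \<and> finite (UNIV - S)"

definition atoms :: "nat set \<Rightarrow> nat set" where
  "atoms S = {a \<in> S. a \<noteq> 0 \<and> \<not> (\<exists>x\<in>S. \<exists>y\<in>S. x \<noteq> 0 \<and> y \<noteq> 0 \<and> a = x + y)}"

definition semigroup_multiplicity :: "nat set \<Rightarrow> nat" where
  "semigroup_multiplicity S = (LEAST x. x \<in> S \<and> x \<noteq> 0)"

(* Differences are taken in the integers, so on nat membership of y - x in S
   is guarded by x \<le> y. *)

definition apery_set :: "nat set \<Rightarrow> nat set" where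
  "apery_set S =
     {x \<in> S. \<not> (semigroup_multiplicity S \<le> x \<and> x - semigroup_multiplicity S \<in> S)}"

definition apery_order :: "nat set \<Rightarrow> (nat \<times> nat) set" where
  "apery_order S = {(x, y) \<in> apery_set S \<times> apery_set S. x \<le> y \<and> y - x \<in> S}"

definition covered_by :: "('a \<times> 'a) set \<Rightarrow> 'a \<Rightarrow> 'a \<Rightarrow> bool" where
  "covered_by r x y \<longleftrightarrow>
     (x, y) \<in> r \<and> x \<noteq> y \<and>
     \<not> (\<exists>z. z \<noteq> x \<and> z \<noteq> y \<and> (x, z) \<in> r \<and> (z, y) \<in> r)"

definition graded_poset :: "'a set \<Rightarrow> ('a \<times> 'a) set \<Rightarrow> bool" where
  "graded_poset A r \<longleftrightarrow>
     finite A \<and> partial_order_on A r \<and>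
     (\<exists>rk :: 'a \<Rightarrow> int. \<forall>x\<in>A. \<forall>y\<in>A. covered_by r x y \<longrightarrow> rk y = rk x + 1)"

definition factorizations :: "nat set \<Rightarrow> nat \<Rightarrow> nat multiset set" where
  "factorizations S x = {F. set_mset F \<subseteq> atoms S \<and> sum_mset F = x}"

definition factorization_lengths :: "nat set \<Rightarrow> nat \<Rightarrow> nat set" where
  "factorization_lengths S x = size ` factorizations S x"

definition elasticity :: "nat set \<Rightarrow> nat \<Rightarrow> rat" where
  "elasticity S x =
     (if x = 0 then 1
      else of_nat (Max (factorization_lengths S x)) / of_nat (Min (factorization_lengths S x)))"

definition half_factorial :: "nat set \<Rightarrow> nat \<Rightarrow> bool" where
  "half_factorial S x \<longleftrightarrow> elasticity S x = 1"

definition apery_half_factorial :: "nat set \<Rightarrow> bool" where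
  "apery_half_factorial S \<longleftrightarrow> (\<forall>x\<in>apery_set S. half_factorial S x)"

lemma semigroup_multiplicity_in:
  assumes "numerical_semigroup S"
  shows "semigroup_multiplicity S \<in> S" and "semigroup_multiplicity S \<noteq> 0"
proof -
  have "finite (insert 0 (UNIV - S))"
    using assms by (simp add: numerical_semigroup_def)
  then obtain x where "x \<notin> insert 0 (UNIV - S)"
    using ex_new_if_finite infinite_UNIV_nat by blast
  then have "x \<in> S \<and> x \<noteq> 0" by simp
  then have "semigroup_multiplicity S \<in> S \<and> semigroup_multiplicity S \<noteq> 0"
    unfolding semigroup_multiplicity_def by (rule LeastI)
  then show "semigroup_multiplicity S \<in> S" "semigroup_multiplicity S \<noteq> 0" by auto
qed

lemma finite_apery_set:
  assumes "numerical_semigroup S"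
  shows "finite (apery_set S)"
proof -
  let ?m = "semigroup_multiplicity S"
  have "apery_set S \<subseteq> {..<?m} \<union> (\<lambda>x. x + ?m) ` (UNIV - S)"
  proof
    fix x assume x: "x \<in> apery_set S"
    show "x \<in> {..<?m} \<union> (\<lambda>x. x + ?m) ` (UNIV - S)"
    proof (cases "x < ?m")
      case False
      then have "x - ?m \<in> UNIV - S" "x = (x - ?m) + ?m"
        using x by (auto simp: apery_set_def)
      then show ?thesis by blast
    qed simp
  qed
  moreover have "finite ({..<?m} \<union> (\<lambda>x. x + ?m) ` (UNIV - S))"
    using assms by (simp add: numerical_semigroup_def)
  ultimately show ?thesis by (rule finite_subset)
qed

lemma partial_order_on_apery_order:
  assumes "numerical_semigroup S"
  shows "partial_order_on (apery_set S) (apery_order S)"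
proof -
  have "trans (apery_order S)"
  proof (rule transI)
    fix x y z assume xy: "(x, y) \<in> apery_order S" and yz: "(y, z) \<in> apery_order S"
    then have "z - y \<in> S" "y - x \<in> S"
      by (auto simp: apery_order_def)
    then have "(z - y) + (y - x) \<in> S"
      using assms unfolding numerical_semigroup_def by blast
    moreover have "(z - y) + (y - x) = z - x"
      using xy yz by (auto simp: apery_order_def)
    ultimately have "z - x \<in> S" by simp
    then show "(x, z) \<in> apery_order S"
      using xy yz by (auto simp: apery_order_def)
  qed
  then show ?thesis
    using assms
    by (auto simp: partial_order_on_def preorder_on_def refl_on_def antisym_def
        apery_order_def numerical_semigroup_def)
qed

lemma sum_mset_atoms_ge_size:
  assumes "set_mset F \<subseteq> atoms S"
  shows "size F \<le> sum_mset F"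
  using assms by (induction F) (auto simp: atoms_def)

lemma finite_factorization_lengths: "finite (factorization_lengths S x)"
proof (rule finite_subset)
  show "factorization_lengths S x \<subseteq> {..x}"
    using sum_mset_atoms_ge_size
    by (auto simp: factorization_lengths_def factorizations_def)
qed simp

lemma factorization_lengths_nonempty:
  assumes "x \<in> S"
  shows "factorization_lengths S x \<noteq> {}"
proof -
  have "\<exists>F. set_mset F \<subseteq> atoms S \<and> sum_mset F = x"
    using assms
  proof (induction x rule: less_induct)
    case (less x)
    consider "x = 0" | "x \<in> atoms S"
      | y z where "y \<in> S" "z \<in> S" "y \<noteq> 0" "z \<noteq> 0" "x = y + z"
      using less.prems by (auto simp: atoms_def)
    then show ?case
    proof cases
      case 1
      then show ?thesis by (intro exI[of _ "{#}"]) simp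
    next
      case 2
      then show ?thesis by (intro exI[of _ "{#x#}"]) simp
    next
      case 3
      then obtain F G where "set_mset F \<subseteq> atoms S" "sum_mset F = y"
        "set_mset G \<subseteq> atoms S" "sum_mset G = z"
        using less.IH[of y] less.IH[of z] by auto
      then show ?thesis using 3 by (intro exI[of _ "F + G"]) auto
    qed
  qed
  then show ?thesis by (auto simp: factorization_lengths_def factorizations_def)
qed

lemma zero_notin_factorization_lengths:
  "x \<noteq> 0 \<Longrightarrow> 0 \<notin> factorization_lengths S x"
  by (auto simp: factorization_lengths_def factorizations_def)

end

theory Submission
  imports Defs
begin

text \<open>
  The Apery set is closed under taking summands in \<open>S\<close>: if \<open>x + y - m\<close> is outside \<open>S\<close> for the
  multiplicity \<open>m\<close>, so is \<open>x - m\<close>, since adding \<open>y\<close> to an element of \<open>S\<close> cannot leave \<open>S\<close>. Hence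
  nothing lying between two Apery elements in the divisibility order of \<open>S\<close> is missing from the
  Apery poset, and a cover relation there is exactly the addition of one atom
  (\<open>covered_by_apery_iff\<close>). Saturated chains from \<open>0\<close> to an Apery element \<open>x\<close> are therefore the
  factorizations of \<open>x\<close> with an ordering of their atoms, and the length of the chain is the number
  of atoms.

  A rank function thus counts atoms: along any factorization of \<open>x\<close> it climbs by one per atom, so
  every factorization of an Apery element \<open>x\<close> has length \<open>rk x - rk 0\<close>
  (\<open>rank_eq_size_factorization\<close>). Conversely, if all factorizations of each Apery element have the same length, that common length is a rank
  function, because adjoining an atom to a factorization makes it longer by one.
\<close>

lemma sum_mset_atoms_in:
  assumes "numerical_semigroup S" and "set_mset F \<subseteq> atoms S"
  shows "sum_mset F \<in> S"
  using assms(2)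
proof (induction F)
  case empty
  then show ?case using assms(1) by (simp add: numerical_semigroup_def)
next
  case (add a F)
  then show ?case using assms(1) by (auto simp: numerical_semigroup_def atoms_def)
qed

lemma apery_set_summand:
  assumes S: "numerical_semigroup S" and "x \<in> S" "y \<in> S" and xy: "x + y \<in> apery_set S"
  shows "x \<in> apery_set S"
proof -
  let ?m = "semigroup_multiplicity S"
  have False if "?m \<le> x" "x - ?m \<in> S"
  proof -
    have "(x - ?m) + y \<in> S"
      using S \<open>y \<in> S\<close> that(2) unfolding numerical_semigroup_def by blast
    then show False using xy that(1) by (simp add: apery_set_def)
  qed
  then show ?thesis using \<open>x \<in> S\<close> by (auto simp: apery_set_def)
qed

text \<open>
  An element strictly between \<open>x\<close> and \<open>y\<close> is \<open>x + u\<close> for a splitting \<open>y - x = u + v\<close> into nonzero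
  elements of \<open>S\<close>. Closure under summands puts every such \<open>x + u\<close> into the Apery set, so the
  absence of intermediate elements says precisely that \<open>y - x\<close> does not split.
\<close>

lemma covered_by_apery_iff:
  assumes S: "numerical_semigroup S"
  shows "covered_by (apery_order S) x y \<longleftrightarrow>
    x \<in> S \<and> y \<in> apery_set S \<and> (\<exists>a\<in>atoms S. y = x + a)"
proof
  assume cov: "covered_by (apery_order S) x y"
  then have x: "x \<in> S" and y: "y \<in> apery_set S" and le: "x \<le> y" and d: "y - x \<in> S" and "x \<noteq> y"
    by (auto simp: covered_by_def apery_order_def apery_set_def)
  have False if u: "u \<in> S" "u \<noteq> 0" and v: "v \<in> S" "v \<noteq> 0" and uv: "y - x = u + v" for u v
  proof -
    have y_eq: "y = (x + u) + v" using uv le by simp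
    have xu: "x + u \<in> S" using S x u(1) by (simp add: numerical_semigroup_def)
    have "x + u \<in> apery_set S"
      using apery_set_summand[OF S xu v(1)] y y_eq by simp
    then have "(x, x + u) \<in> apery_order S" "(x + u, y) \<in> apery_order S"
      using cov y y_eq u(1) v(1) by (auto simp: covered_by_def apery_order_def)
    moreover have "x + u \<noteq> x" "x + u \<noteq> y" using u(2) v(2) y_eq by auto
    ultimately show False using cov unfolding covered_by_def by blast
  qed
  then have "y - x \<in> atoms S"
    using d le \<open>x \<noteq> y\<close> unfolding atoms_def by auto
  then show "x \<in> S \<and> y \<in> apery_set S \<and> (\<exists>a\<in>atoms S. y = x + a)"
    using x y le by (intro conjI bexI[of _ "y - x"]) auto
next
  assume "x \<in> S \<and> y \<in> apery_set S \<and> (\<exists>a\<in>atoms S. y = x + a)"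
  then obtain a where x: "x \<in> S" and y: "y \<in> apery_set S" and a: "a \<in> atoms S" and y_eq: "y = x + a"
    by blast
  from a have "a \<in> S" "a \<noteq> 0" by (auto simp: atoms_def)
  have "x \<in> apery_set S"
    using apery_set_summand[OF S x \<open>a \<in> S\<close>] y y_eq by simp
  then have "(x, y) \<in> apery_order S"
    using y y_eq \<open>a \<in> S\<close> by (simp add: apery_order_def)
  moreover have False if "z \<noteq> x" "z \<noteq> y" "(x, z) \<in> apery_order S" "(z, y) \<in> apery_order S" for z
  proof -
    have "z - x \<in> S" "y - z \<in> S" "z - x \<noteq> 0" "y - z \<noteq> 0" "a = (z - x) + (y - z)"
      using that y_eq by (auto simp: apery_order_def)
    then show False using a unfolding atoms_def by blast
  qed
  ultimately show "covered_by (apery_order S) x y"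
    using y_eq \<open>a \<noteq> 0\<close> unfolding covered_by_def by auto
qed

lemma half_factorial_iff:
  assumes "x \<in> S"
  shows "half_factorial S x \<longleftrightarrow> (\<forall>k\<in>factorization_lengths S x. \<forall>l\<in>factorization_lengths S x. k = l)"
proof (cases "x = 0")
  case True
  \<comment> \<open>Elasticity \<open>1\<close> at \<open>0\<close> is a convention; it fits, as \<open>0\<close> has only the empty factorization.\<close>
  have "l = 0" if "l \<in> factorization_lengths S 0" for l
  proof -
    from that obtain F where F: "set_mset F \<subseteq> atoms S" "sum_mset F = 0" "l = size F"
      by (auto simp: factorization_lengths_def factorizations_def)
    then have "F = {#}" by (cases F) (auto simp: atoms_def)
    then show ?thesis using F by simp
  qed
  then show ?thesis using True by (auto simp: half_factorial_def elasticity_def)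
next
  case False
  let ?L = "factorization_lengths S x"
  have fin: "finite ?L" and ne: "?L \<noteq> {}"
    using finite_factorization_lengths factorization_lengths_nonempty[OF assms] by auto
  have "Min ?L \<noteq> 0"
    using Min_in[OF fin ne] zero_notin_factorization_lengths[OF False] by metis
  then have "of_nat (Max ?L) / of_nat (Min ?L) = (1 :: rat) \<longleftrightarrow> Max ?L = Min ?L"
    by (subst divide_eq_1_iff) simp
  then have "half_factorial S x \<longleftrightarrow> Max ?L = Min ?L"
    unfolding half_factorial_def elasticity_def using False by (simp only: if_False)
  also have "\<dots> \<longleftrightarrow> (\<forall>k\<in>?L. \<forall>l\<in>?L. k = l)"
  proof
    assume eq: "Max ?L = Min ?L"
    have "k = Min ?L" if "k \<in> ?L" for k
      using Max_ge[OF fin that] Min_le[OF fin that] eq by simp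
    then show "\<forall>k\<in>?L. \<forall>l\<in>?L. k = l" by blast
  qed (use Max_in[OF fin ne] Min_in[OF fin ne] in blast)
  finally show ?thesis .
qed

text \<open>
  The partial sums of a factorization, its atoms taken in any order, form a saturated chain from
  \<open>0\<close>: they stay in the Apery set by closure under summands, and each step adds an atom.
\<close>

lemma rank_eq_size_factorization:
  fixes rk :: "nat \<Rightarrow> int"
  assumes S: "numerical_semigroup S"
    and rk: "\<And>x y. covered_by (apery_order S) x y \<Longrightarrow> rk y = rk x + 1"
    and "set_mset F \<subseteq> atoms S" "sum_mset F \<in> apery_set S"
  shows "rk (sum_mset F) = rk 0 + int (size F)"
  using assms(3,4)
proof (induction F)
  case empty
  then show ?case by simp
next
  case (add a F)
  then have a: "a \<in> atoms S" and F: "set_mset F \<subseteq> atoms S" and Ap: "sum_mset F + a \<in> apery_set S"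
    by (auto simp: add.commute)
  have "a \<in> S" using a by (simp add: atoms_def)
  have sF: "sum_mset F \<in> S" using sum_mset_atoms_in[OF S F] .
  have "rk (sum_mset F + a) = rk (sum_mset F) + 1"
  proof (rule rk)
    show "covered_by (apery_order S) (sum_mset F) (sum_mset F + a)"
      unfolding covered_by_apery_iff[OF S] using sF Ap a by blast
  qed
  moreover have "rk (sum_mset F) = rk 0 + int (size F)"
    by (rule add.IH[OF F apery_set_summand[OF S sF \<open>a \<in> S\<close> Ap]])
  ultimately show ?case by (simp add: add.commute)
qed

theorem theorem1p1:
  fixes S :: "nat set"
  assumes "numerical_semigroup S"
  shows "graded_poset (apery_set S) (apery_order S) \<longleftrightarrow> apery_half_factorial S"
proof
  assume "graded_poset (apery_set S) (apery_order S)"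
  then obtain rk :: "nat \<Rightarrow> int" where
    "\<forall>x\<in>apery_set S. \<forall>y\<in>apery_set S. covered_by (apery_order S) x y \<longrightarrow> rk y = rk x + 1"
    by (auto simp: graded_poset_def)
  then have rk: "rk y = rk x + 1" if "covered_by (apery_order S) x y" for x y
    using that by (auto simp: covered_by_def apery_order_def)
  have len: "int l = rk x - rk 0" if x: "x \<in> apery_set S" and l: "l \<in> factorization_lengths S x" for x l
  proof -
    obtain F where F: "set_mset F \<subseteq> atoms S" "sum_mset F = x" "l = size F"
      using l by (auto simp: factorization_lengths_def factorizations_def)
    have "rk (sum_mset F) = rk 0 + int (size F)"
    proof (rule rank_eq_size_factorization[OF assms _ F(1)])
      show "rk y = rk x + 1" if "covered_by (apery_order S) x y" for x y
        using rk that .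
      show "sum_mset F \<in> apery_set S" using F(2) x by simp
    qed
    then show ?thesis using F by simp
  qed
  have "half_factorial S x" if x: "x \<in> apery_set S" for x
  proof -
    have "x \<in> S" using x by (simp add: apery_set_def)
    moreover have "k = l" if "k \<in> factorization_lengths S x" "l \<in> factorization_lengths S x" for k l
      using len[OF x that(1)] len[OF x that(2)] by simp
    ultimately show ?thesis using half_factorial_iff by blast
  qed
  then show "apery_half_factorial S" by (simp add: apery_half_factorial_def)
next
  assume hf: "apery_half_factorial S"
  \<comment> \<open>On the Apery set all lengths agree, so the minimum is just a way to name the common one.\<close>
  define rk where "rk x = int (Min (factorization_lengths S x))" for x
  have rk: "rk x = int l" if "x \<in> apery_set S" "l \<in> factorization_lengths S x" for x l
  proof -
    have "x \<in> S" using that(1) by (simp add: apery_set_def)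
    have "half_factorial S x" using hf that(1) by (simp add: apery_half_factorial_def)
    moreover have "Min (factorization_lengths S x) \<in> factorization_lengths S x"
      using that(2) by (intro Min_in finite_factorization_lengths) auto
    ultimately have "Min (factorization_lengths S x) = l"
      using half_factorial_iff[OF \<open>x \<in> S\<close>] that(2) by blast
    then show ?thesis by (simp add: rk_def)
  qed
  have "rk y = rk x + 1"
    if x: "x \<in> apery_set S" and y: "y \<in> apery_set S" and cov: "covered_by (apery_order S) x y" for x y
  proof -
    obtain a where a: "a \<in> atoms S" and y_eq: "y = x + a" and "x \<in> S"
      using cov unfolding covered_by_apery_iff[OF assms] by blast
    obtain F where F: "set_mset F \<subseteq> atoms S" "sum_mset F = x"
      using factorization_lengths_nonempty[OF \<open>x \<in> S\<close>]
      by (auto simp: factorization_lengths_def factorizations_def)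
    have "rk x = int (size F)"
      using F by (intro rk[OF x]) (auto simp: factorization_lengths_def factorizations_def)
    moreover have "rk y = int (size (add_mset a F))"
    proof (rule rk[OF y])
      show "size (add_mset a F) \<in> factorization_lengths S y"
        unfolding factorization_lengths_def factorizations_def
        using F a y_eq by (intro imageI) (simp add: add.commute)
    qed
    ultimately show ?thesis by simp
  qed
  then show "graded_poset (apery_set S) (apery_order S)"
    unfolding graded_poset_def
    using finite_apery_set[OF assms] partial_order_on_apery_order[OF assms] by blast
qed

end
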